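(* For every $n\in\mathbb{N}$, $2n-1\leq \chi'^t_d(K_{2n})\leq 4n-2$ and $2n\leq \chi'^t_d(K_{2n+1})\leq 4n-1$, where $K_r$ denotes the complete graph on $r$ vertices.
   Context: Graphs are simple. Two edges are adjacent if they are distinct and share an endpoint. A total dominator edge coloring (TDE-coloring) of a graph $G$ is a proper edge coloring of $G$ in which each edge of $G$ is adjacent to every edge of some color class (a color class is the set of all edges assigned a given used color). The total dominator edge chromatic number $\chi'^t_d(G)$ is the minimum number of color classes in a TDE-coloring of $G$.
   Formalization: Here n ≥ 1, and the upper bound for K_{2n} is claimed only for n ≥ 2, since K_2 has a single edge adjacent to no edge and so has no TDE-coloring; the lower bound for K_2 holds by the convention that the minimum over no colorings is infinity. *)

theory Defs
  imports "HOL-Library.Ramsey" "HOL-Library.Extended_Nat"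
begin

(* A graph is a pair of a vertex set and an edge set; an edge is the two-element
   set of its endpoints, so [V]^2 (from Ramsey) is the set of all possible edges. *)

type_synonym 'a graph = "'a set \<times> 'a set set"

abbreviation verts :: "'a graph \<Rightarrow> 'a set" where
  "verts G \<equiv> fst G"

abbreviation edges :: "'a graph \<Rightarrow> 'a set set" where
  "edges G \<equiv> snd G"

definition simple_graph :: "'a graph \<Rightarrow> bool" where
  "simple_graph G \<longleftrightarrow> finite (verts G) \<and> edges G \<subseteq> [verts G]\<^bsup>2\<^esup>"

definition complete_graph :: "nat \<Rightarrow> nat graph" where
  "complete_graph r = ({..<r}, [{..<r}]\<^bsup>2\<^esup>)"

lemma simple_graph_complete_graph: "simple_graph (complete_graph r)"
  by (simp add: simple_graph_def complete_graph_def)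

definition adjacent_edges :: "'a set \<Rightarrow> 'a set \<Rightarrow> bool" where
  "adjacent_edges e f \<longleftrightarrow> e \<noteq> f \<and> e \<inter> f \<noteq> {}"

definition proper_edge_coloring :: "'a graph \<Rightarrow> ('a set \<Rightarrow> nat) \<Rightarrow> bool" where
  "proper_edge_coloring G c \<longleftrightarrow>
     (\<forall>e\<in>edges G. \<forall>f\<in>edges G. adjacent_edges e f \<longrightarrow> c e \<noteq> c f)"

(* Only colors in c ` edges G, that is, colors actually used, give a class;
   in particular every color class is nonempty. *)
definition color_classes :: "'a graph \<Rightarrow> ('a set \<Rightarrow> nat) \<Rightarrow> 'a set set set" where
  "color_classes G c = (\<lambda>k. {e \<in> edges G. c e = k}) ` (c ` edges G)"

definition TDE_coloring :: "'a graph \<Rightarrow> ('a set \<Rightarrow> nat) \<Rightarrow> bool" where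
  "TDE_coloring G c \<longleftrightarrow>
     proper_edge_coloring G c \<and>
     (\<forall>e\<in>edges G. \<exists>C\<in>color_classes G c. \<forall>f\<in>C. adjacent_edges e f)"

(* Taken in enat, the infimum is a minimum whenever a TDE-coloring exists,
   and it is infinity when there is none.  It is meant for simple_graph G, whose
   edge set is finite, so that card is the actual number of color classes. *)
definition TDE_chromatic_number :: "'a graph \<Rightarrow> enat" where
  "TDE_chromatic_number G = (INF c\<in>{c. TDE_coloring G c}. enat (card (color_classes G c)))"

(* The only edge of K_2 is not adjacent to any edge, so K_2 has no TDE-coloring:
   an upper bound on its total dominator edge chromatic number cannot hold. *)
lemma no_TDE_coloring_complete_graph_2: "\<not> TDE_coloring (complete_graph 2) c"
proof -
  have "{..<2::nat} = {0, 1}"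
    by auto
  then have "[{..<2::nat}]\<^bsup>2\<^esup> = {{0, 1}}"
    by simp
  then show ?thesis
    by (auto simp: TDE_coloring_def color_classes_def complete_graph_def adjacent_edges_def)
qed

lemma TDE_chromatic_number_complete_graph_2:
  "TDE_chromatic_number (complete_graph 2) = \<infinity>"
  by (simp add: TDE_chromatic_number_def no_TDE_coloring_complete_graph_2 top_enat_def)

end

theory Submission
  imports Defs "HOL-Number_Theory.Cong"
begin

text \<open>
  For the lower bounds, the edges at one vertex are pairwise adjacent, so a proper coloring gives
  them pairwise different colors, and a vertex of \<open>K\<^sub>r\<close> has degree \<open>r - 1\<close>.

  For the upper bounds, single out one vertex \<open>m\<close> of \<open>K\<^bsub>m+1\<^esub>\<close>, where \<open>m \<ge> 2\<close>,
  and give each of its \<open>m\<close> edges a private color. Their color classes are singletons, so an edge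
  is adjacent to the whole of such a class as soon as it meets its only edge in one vertex. Every
  edge does so for some class: an edge \<open>xy\<close> avoiding \<open>m\<close> meets \<open>xm\<close>, and an edge at \<open>m\<close> meets any
  other edge at \<open>m\<close>. Hence any proper coloring of the remaining \<open>K\<^sub>m\<close> with \<open>q\<close> colors extends to a
  TDE-coloring with at most \<open>q + m\<close> classes (\<open>TDE_chromatic_number_complete_graph_Suc_le\<close>).

  With \<open>q = 2n - 1\<close>, the classical cyclic coloring
  (\<open>proper_edge_coloring_cyclic_coloring\<close>) colors both \<open>K\<^bsub>2n-1\<^esub>\<close> and \<open>K\<^bsub>2n\<^esub>\<close> with
  \<open>q\<close> colors. Taking \<open>m = q\<close> gives the bound \<open>2q = 4n - 2\<close> for \<open>K\<^bsub>2n\<^esub>\<close>; here \<open>m \<ge> 2\<close> means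
  \<open>n \<ge> 2\<close>. Taking \<open>m = q + 1\<close> gives \<open>2q + 1 = 4n - 1\<close> for \<open>K\<^bsub>2n+1\<^esub>\<close>.
\<close>

section \<open>Edge colorings of complete graphs\<close>

lemma edges_complete_graph_iff:
  "e \<in> edges (complete_graph r) \<longleftrightarrow> (\<exists>x y. e = {x, y} \<and> x < y \<and> y < r)"
proof
  assume "e \<in> edges (complete_graph r)"
  then obtain x y where "e = {x, y}" "x < r" "y < r" "x \<noteq> y"
    by (auto simp: complete_graph_def nsets_2_eq)
  then show "\<exists>x y. e = {x, y} \<and> x < y \<and> y < r"
    by (metis insert_commute linorder_neq_iff)
qed (auto simp: complete_graph_def)

lemma finite_edges_complete_graph: "finite (edges (complete_graph r))"
  by (simp add: complete_graph_def finite_imp_finite_nsets)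

text \<open>Two edges at a common vertex \<open>x\<close> can be named by their other endpoints, which turns
  properness into the injectivity of the colors seen from each vertex.\<close>

lemma proper_edge_coloring_complete_graph_iff:
  "proper_edge_coloring (complete_graph r) c \<longleftrightarrow>
     (\<forall>x<r. inj_on (\<lambda>y. c {x, y}) ({..<r} - {x}))"
proof
  assume proper: "proper_edge_coloring (complete_graph r) c"
  show "\<forall>x<r. inj_on (\<lambda>y. c {x, y}) ({..<r} - {x})"
  proof (intro allI impI inj_onI)
    fix x y z
    assume "x < r" and y: "y \<in> {..<r} - {x}" and z: "z \<in> {..<r} - {x}"
      and same: "c {x, y} = c {x, z}"
    then have "{x, y} \<in> edges (complete_graph r)" "{x, z} \<in> edges (complete_graph r)"
      by (auto simp: complete_graph_def)
    with proper same have "\<not> adjacent_edges {x, y} {x, z}"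
      unfolding proper_edge_coloring_def by blast
    then show "y = z"
      by (auto simp: adjacent_edges_def doubleton_eq_iff)
  qed
next
  assume inj: "\<forall>x<r. inj_on (\<lambda>y. c {x, y}) ({..<r} - {x})"
  show "proper_edge_coloring (complete_graph r) c"
    unfolding proper_edge_coloring_def
  proof (intro ballI impI)
    fix e f
    assume e: "e \<in> edges (complete_graph r)" and f: "f \<in> edges (complete_graph r)"
      and "adjacent_edges e f"
    then obtain x where "x \<in> e" "x \<in> f" "e \<noteq> f"
      by (auto simp: adjacent_edges_def)
    with e f obtain y z where "e = {x, y}" "f = {x, z}" "x < r"
      "y \<in> {..<r} - {x}" "z \<in> {..<r} - {x}" "y \<noteq> z"
      by (auto simp: complete_graph_def nsets_2_eq)
    with inj show "c e \<noteq> c f"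
      by (metis inj_onD)
  qed
qed

lemma card_color_classes: "card (color_classes G c) = card (c ` edges G)"
  unfolding color_classes_def
proof (rule card_image)
  show "inj_on (\<lambda>k. {e \<in> edges G. c e = k}) (c ` edges G)"
    by (auto simp: inj_on_def)
qed

section \<open>The lower bound from the degree\<close>

lemma le_TDE_chromatic_number_complete_graph:
  assumes "r \<ge> 1"
  shows "enat (r - 1) \<le> TDE_chromatic_number (complete_graph r)"
  unfolding TDE_chromatic_number_def
proof (rule INF_greatest)
  fix c
  assume "c \<in> {c. TDE_coloring (complete_graph r) c}"
  then have "inj_on (\<lambda>y. c {0, y}) ({..<r} - {0})"
    using assms by (auto simp: TDE_coloring_def proper_edge_coloring_complete_graph_iff)
  then have "card ((\<lambda>y. c {0, y}) ` ({..<r} - {0})) = card ({..<r} - {0})"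
    by (rule card_image)
  also have "\<dots> = r - 1"
    using assms by simp
  finally have star: "card ((\<lambda>y. c {0, y}) ` ({..<r} - {0})) = r - 1" .
  have "(\<lambda>y. c {0, y}) ` ({..<r} - {0}) \<subseteq> c ` edges (complete_graph r)"
    using assms by (auto simp: complete_graph_def)
  then have "r - 1 \<le> card (c ` edges (complete_graph r))"
    using finite_edges_complete_graph by (metis card_mono finite_imageI star)
  then show "enat (r - 1) \<le> enat (card (color_classes (complete_graph r) c))"
    by (simp add: card_color_classes)
qed

section \<open>Extending a proper coloring by a star of private colors\<close>

text \<open>As \<open>m\<close> is the largest vertex of \<open>K\<^bsub>m+1\<^esub>\<close>, the other endpoint of an edge \<open>e\<close> at \<open>m\<close> is
  \<open>Min e\<close>. When \<open>d\<close> uses only colors below \<open>q\<close>, no other edge has the color \<open>q + Min e\<close>.\<close>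

definition star_extension :: "nat \<Rightarrow> nat \<Rightarrow> (nat set \<Rightarrow> nat) \<Rightarrow> nat set \<Rightarrow> nat" where
  "star_extension m q d e = (if m \<in> e then q + Min e else d e)"

text \<open>For \<open>m = 1\<close> the only edge of \<open>K\<^sub>2\<close> has no neighbor; from \<open>m = 2\<close> on, an edge at the new
  vertex is adjacent to another one there.\<close>

lemma TDE_coloring_star_extension:
  assumes "m \<ge> 2" and proper: "proper_edge_coloring (complete_graph m) d"
    and less: "\<And>e. e \<in> edges (complete_graph m) \<Longrightarrow> d e < q"
  shows "TDE_coloring (complete_graph (Suc m)) (star_extension m q d)"
proof -
  let ?G = "complete_graph (Suc m)" and ?c = "star_extension m q d"
  have star: "?c {x, m} = q + x" "?c {m, x} = q + x" if "x < m" for x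
    using that by (simp_all add: star_extension_def min_def)
  have old: "?c {x, y} = d {x, y}" "d {x, y} < q" if "x < m" "y < m" "x \<noteq> y" for x y
    using that less[of "{x, y}"] by (auto simp: star_extension_def complete_graph_def)
  have "inj_on (\<lambda>y. ?c {x, y}) ({..<Suc m} - {x})" if "x < Suc m" for x
  proof (cases "x = m")
    case True
    then show ?thesis
      by (auto simp: inj_on_def less_Suc_eq star)
  next
    case False
    with that have "x < m"
      by simp
    with proper have "inj_on (\<lambda>y. d {x, y}) ({..<m} - {x})"
      by (simp add: proper_edge_coloring_complete_graph_iff)
    then have "inj_on (\<lambda>y. ?c {x, y}) ({..<m} - {x})"
      using \<open>x < m\<close> by (simp add: inj_on_def old(1))
    \<comment> \<open>The color \<open>q + x\<close> of \<open>xm\<close> exceeds every color used inside \<open>K\<^sub>m\<close>.\<close>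
    moreover have "?c {x, m} \<notin> (\<lambda>y. ?c {x, y}) ` ({..<m} - {x})"
    proof
      assume "?c {x, m} \<in> (\<lambda>y. ?c {x, y}) ` ({..<m} - {x})"
      then obtain y where "y < m" "y \<noteq> x" "?c {x, m} = ?c {x, y}"
        by auto
      then show False
        using \<open>x < m\<close> old[of x y] star(1)[of x] by simp
    qed
    moreover have "{..<Suc m} - {x} = insert m ({..<m} - {x})"
      using \<open>x < m\<close> by auto
    ultimately show ?thesis
      by simp
  qed
  then have "proper_edge_coloring ?G ?c"
    by (simp add: proper_edge_coloring_complete_graph_iff)
  moreover have "\<exists>C\<in>color_classes ?G ?c. \<forall>f\<in>C. adjacent_edges e f" if edge: "e \<in> edges ?G" for e
  proof -
    have "{{x, m}} \<in> color_classes ?G ?c" if "x < m" for x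
    proof -
      have xm: "{x, m} \<in> edges ?G"
        using that by (simp add: complete_graph_def)
      have "{f \<in> edges ?G. ?c f = q + x} = {{x, m}}"
      proof (intro equalityI subsetI)
        fix f
        assume "f \<in> {f \<in> edges ?G. ?c f = q + x}"
        then obtain a b where f: "f = {a, b}" "a < b" "b < Suc m" "?c f = q + x"
          by (auto simp: edges_complete_graph_iff)
        have "b = m"
        proof (rule ccontr)
          assume "b \<noteq> m"
          then show False
            using f old[of a b] by simp
        qed
        with f show "f \<in> {{x, m}}"
          using star(1)[of a] by simp
      qed (use xm star(1)[OF that] in simp)
      moreover have "q + x \<in> ?c ` edges ?G"
        using xm star(1)[OF that] by (rule rev_image_eqI[OF _ sym])
      ultimately show ?thesis
        unfolding color_classes_def by (rule rev_image_eqI[OF _ sym, rotated])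
    qed
    moreover have "\<exists>x<m. adjacent_edges e {x, m}"
    proof -
      obtain a b where e: "e = {a, b}" "a < b" "b < Suc m"
        using edge by (auto simp: edges_complete_graph_iff)
      show ?thesis
      proof (cases "b = m")
        case True
        define x :: nat where "x = (if a = 0 then 1 else 0)"
        have "x < m" "x \<noteq> a"
          using \<open>m \<ge> 2\<close> by (auto simp: x_def)
        with e True show ?thesis
          by (intro exI[of _ x]) (auto simp: adjacent_edges_def doubleton_eq_iff)
      next
        case False
        with e show ?thesis
          by (intro exI[of _ a]) (auto simp: adjacent_edges_def doubleton_eq_iff)
      qed
    qed
    ultimately show ?thesis
      by blast
  qed
  ultimately show ?thesis
    by (simp add: TDE_coloring_def)
qed

lemma TDE_chromatic_number_complete_graph_Suc_le:
  assumes "m \<ge> 2" "proper_edge_coloring (complete_graph m) d"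
    and less: "\<And>e. e \<in> edges (complete_graph m) \<Longrightarrow> d e < q"
  shows "TDE_chromatic_number (complete_graph (Suc m)) \<le> enat (q + m)"
proof -
  let ?G = "complete_graph (Suc m)" and ?c = "star_extension m q d"
  have "?c ` edges ?G \<subseteq> {..<q + m}"
  proof (rule image_subsetI)
    fix e
    assume "e \<in> edges ?G"
    then obtain a b where e: "e = {a, b}" "a < b" "b < Suc m"
      by (auto simp: edges_complete_graph_iff)
    show "?c e \<in> {..<q + m}"
    proof (cases "b = m")
      case True
      with e show ?thesis
        by (simp add: star_extension_def)
    next
      case False
      with e have "d e < q"
        by (intro less) (auto simp: complete_graph_def)
      with e False show ?thesis
        by (simp add: star_extension_def)
    qed
  qed
  then have "card (color_classes ?G ?c) \<le> q + m"
    unfolding card_color_classes by (metis card_lessThan card_mono finite_lessThan)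
  moreover have "TDE_chromatic_number ?G \<le> enat (card (color_classes ?G ?c))"
    unfolding TDE_chromatic_number_def
    by (rule INF_lower) (simp add: TDE_coloring_star_extension assms)
  ultimately show ?thesis
    by (meson enat_ord_simps(1) order_trans)
qed

section \<open>The cyclic coloring\<close>

text \<open>The classical coloring of \<open>K\<^bsub>q+1\<^esub>\<close> for odd \<open>q\<close>: the vertices \<open>x, y < q\<close> are residues and \<open>xy\<close>
  gets the color \<open>x + y\<close>. The color \<open>2x\<close>, which would belong to a loop at \<open>x\<close>, is then missing at
  \<open>x\<close> and is given to the edge joining \<open>x\<close> to the extra vertex \<open>q\<close>.\<close>

definition cyclic_coloring :: "nat \<Rightarrow> nat set \<Rightarrow> nat" where
  "cyclic_coloring q e = (if q \<in> e then 2 * Min e else \<Sum>e) mod q"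

text \<open>At a residue \<open>x\<close> the colors are the distinct sums \<open>x + y\<close>, with \<open>y = x\<close> standing for the edge
  to \<open>q\<close>; at \<open>q\<close> they are the doubles \<open>2x\<close>, which are distinct since \<open>2\<close> is invertible modulo the
  odd number \<open>q\<close>.\<close>

lemma proper_edge_coloring_cyclic_coloring:
  assumes "odd q" and "m \<le> Suc q"
  shows "proper_edge_coloring (complete_graph m) (cyclic_coloring q)"
proof -
  have extra: "cyclic_coloring q {x, q} = (x + x) mod q" "cyclic_coloring q {q, x} = (x + x) mod q"
    if "x < q" for x
    using that by (simp_all add: cyclic_coloring_def min_def mult_2)
  have residues: "cyclic_coloring q {x, y} = (x + y) mod q" if "x < q" "y < q" "x \<noteq> y" for x y
    using that by (simp add: cyclic_coloring_def)
  have add_cancel: "y = z" if "(x + y) mod q = (x + z) mod q" "y < q" "z < q" for x y z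
    using that by (metis cong_add_lcancel_nat cong_def mod_less)
  have double_cancel: "x = y" if "(x + x) mod q = (y + y) mod q" "x < q" "y < q" for x y
  proof -
    have "[2 * x = 2 * y] (mod q)"
      using that by (simp add: cong_def mult_2)
    moreover have "coprime 2 q"
      using assms(1) by simp
    ultimately have "[x = y] (mod q)"
      using cong_mult_lcancel_nat by blast
    with that show "x = y"
      by (simp add: cong_def)
  qed
  have "inj_on (\<lambda>y. cyclic_coloring q {x, y}) ({..<m} - {x})" if "x < m" for x
  proof (cases "x = q")
    case True
    with assms(2) have "y < q" if "y \<in> {..<m} - {x}" for y
      using that by auto
    with True show ?thesis
      by (intro inj_onI) (rule double_cancel, simp_all add: extra)
  next
    case False
    with that assms(2) have "x < q"
      by simp
    define other where "other y = (if y = q then x else y)" for y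
    have other: "other y < q" "cyclic_coloring q {x, y} = (x + other y) mod q"
      if "y \<in> {..<m} - {x}" for y
      using that \<open>x < q\<close> assms(2) by (auto simp: other_def extra residues)
    have "inj_on other ({..<m} - {x})"
      by (auto simp: inj_on_def other_def)
    show ?thesis
    proof (rule inj_onI)
      fix y z
      assume y: "y \<in> {..<m} - {x}" and z: "z \<in> {..<m} - {x}"
        and "cyclic_coloring q {x, y} = cyclic_coloring q {x, z}"
      then have "(x + other y) mod q = (x + other z) mod q"
        by (simp only: other)
      then have "other y = other z"
        by (rule add_cancel) (simp_all only: y z other)
      from inj_onD[OF \<open>inj_on other ({..<m} - {x})\<close> this y z] show "y = z" .
    qed
  qed
  then show ?thesis
    by (simp add: proper_edge_coloring_complete_graph_iff)
qed

lemma cyclic_coloring_less: "q > 0 \<Longrightarrow> cyclic_coloring q e < q"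
  by (simp add: cyclic_coloring_def)

section \<open>The bounds\<close>

theorem theorem2p8:
  fixes n :: nat
  assumes "n \<ge> 1"
  shows "enat (2 * n - 1) \<le> TDE_chromatic_number (complete_graph (2 * n)) \<and>
         (n \<noteq> 1 \<longrightarrow> TDE_chromatic_number (complete_graph (2 * n)) \<le> enat (4 * n - 2)) \<and>
         enat (2 * n) \<le> TDE_chromatic_number (complete_graph (2 * n + 1)) \<and>
         TDE_chromatic_number (complete_graph (2 * n + 1)) \<le> enat (4 * n - 1)"
proof -
  define q where "q = 2 * n - 1"
  have q: "odd q" "q > 0" "Suc q = 2 * n"
    using assms by (auto simp: q_def)
  have upper: "TDE_chromatic_number (complete_graph (Suc m)) \<le> enat (q + m)"
    if "m \<ge> 2" "m \<le> Suc q" for m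
    using TDE_chromatic_number_complete_graph_Suc_le
      [OF that(1) proper_edge_coloring_cyclic_coloring[OF q(1) that(2)] cyclic_coloring_less[OF q(2)]] .
  have "TDE_chromatic_number (complete_graph (2 * n)) \<le> enat (4 * n - 2)" if "n \<noteq> 1"
  proof -
    have "q \<ge> 2" "q + q = 4 * n - 2"
      using assms that by (auto simp: q_def)
    then show ?thesis
      using upper[of q] q(3) by simp
  qed
  moreover have "TDE_chromatic_number (complete_graph (2 * n + 1)) \<le> enat (4 * n - 1)"
  proof -
    have "Suc q \<ge> 2" "q + Suc q = 4 * n - 1"
      using assms by (auto simp: q_def)
    then show ?thesis
      using upper[of "Suc q"] q(3) by simp
  qed
  ultimately show ?thesis
    using le_TDE_chromatic_number_complete_graph[of "2 * n"]
      le_TDE_chromatic_number_complete_graph[of "2 * n + 1"] assms by simp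
qed

end
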